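(* The number $$\theta_1=\frac{r_0^\top Ar_0-\sum_{i\in\pi_k^a}\lambda_i(s_i^\top r_0)^2}{r_0^\top r_0-\sum_{i\in\pi_k^a}(s_i^\top r_0)^2}$$ is the root of the polynomial $p_1^{D}$ defined by $$\{p_1^{D}\}=\arg\min_{p\in\mathbb{P}_1(0)}\sum_{i\in\bar\pi_k^a}\frac{\eta_i^2}{\lambda_i}p(\lambda_i)^2 .$$
   Context: $A\in\mathbb{R}^{n\times n}$ is symmetric positive definite with spectral decomposition $A=S\Lambda S^\top$, $\Lambda=\mathrm{diag}(\lambda_1,\dots,\lambda_n)$, $\lambda_1\ge\dots\ge\lambda_n>0$, $S=[s_1\ \cdots\ s_n]$ orthogonal. $b\in\mathbb{R}^n$, $x^\ast=A^{-1}b$, $x_0\in\mathbb{R}^n$ is an initial guess, $r_0=b-Ax_0$, $\eta_i=s_i^\top r_0$. $\mathbb{P}_1(0)$ is the set of real polynomials of degree at most $1$ with value $1$ at $0$. $k$ is an integer with $1<k<n$. A bar over a subset of $\{1,\dots,n\}$ denotes its complement. $j_0\in\arg\min_{1\le j\le k+1}\lambda_j/\lambda_{n-k+j-1}$, and $\pi_k^a\subset\{1,\dots,n\}$ is the set of $k$ indices with $\bar\pi_k^a=\{j_0,j_0+1,\dots,n-k+j_0-1\}$. Standing assumption: an integer $\ell\ge1$ is fixed and, for every feasible $F$, meaning $F=I_n+SDS^\top$ with $D$ real diagonal, $I_n+D$ positive definite and $\mathrm{rank}(D)\le k$, the preconditioned conjugate gradient method for $Ax=b$ with preconditioner $F$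 started at $x_0$ has not reached the solution $x^\ast$ at iteration $\ell$ (equivalently, in exact arithmetic, the minimizer of $\|x^\ast-x\|_A=\sqrt{(x^\ast-x)^\top A(x^\ast-x)}$ over $x\in x_0+\mathrm{span}\{Fr_0,(FA)Fr_0,\dots,(FA)^{\ell-1}Fr_0\}$ is not $x^\ast$). *)

theory Defs
  imports
    Complex_Main
    "HOL-Computational_Algebra.Polynomial"
    "Jordan_Normal_Form.Matrix"
    "Jordan_Normal_Form.Gauss_Jordan_Elimination"
    "Jordan_Normal_Form.DL_Rank"
begin

definition positive_definite :: "nat \<Rightarrow> real mat \<Rightarrow> bool" where
  "positive_definite n M \<longleftrightarrow>
     M \<in> carrier_mat n n \<and> M\<^sup>T = M \<and>
     (\<forall>v \<in> carrier_vec n. v \<noteq> 0\<^sub>v n \<longrightarrow> 0 < v \<bullet> (M *\<^sub>v v))"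

(* The AFP's orthogonal_mat only asks for pairwise orthogonal (not normalised) columns,
   so orthogonality of S in the sense S^T S = S S^T = I is spelled out here. *)
definition orthonormal_mat :: "nat \<Rightarrow> real mat \<Rightarrow> bool" where
  "orthonormal_mat n S \<longleftrightarrow>
     S \<in> carrier_mat n n \<and> S\<^sup>T * S = 1\<^sub>m n \<and> S * S\<^sup>T = 1\<^sub>m n"

definition feasible_preconditioner :: "nat \<Rightarrow> nat \<Rightarrow> real mat \<Rightarrow> real mat \<Rightarrow> bool" where
  "feasible_preconditioner n k S F \<longleftrightarrow>
     (\<exists>D \<in> carrier_mat n n.
        diagonal_mat D \<and> positive_definite n (1\<^sub>m n + D) \<and> vec_space.rank n D \<le> k \<and>
        F = 1\<^sub>m n + S * D * S\<^sup>T)"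

(* Preconditioned conjugate gradients for A x = b, where F approximates the inverse of A
   (the preconditioned residual is F r).  The state is (iterate, residual, direction).
   After the residual r has become 0, both step quotients are 0 / 0 = 0, so the iterate
   stays at the solution; for positive definite A and F no other breakdown occurs. *)
primrec pcg_state ::
  "real mat \<Rightarrow> real vec \<Rightarrow> real mat \<Rightarrow> real vec \<Rightarrow> nat \<Rightarrow> real vec \<times> real vec \<times> real vec" where
  "pcg_state A b F x0 0 = (let r = b - A *\<^sub>v x0 in (x0, r, F *\<^sub>v r))"
| "pcg_state A b F x0 (Suc m) =
     (let (x, r, p) = pcg_state A b F x0 m;
          \<alpha> = (r \<bullet> (F *\<^sub>v r)) / (p \<bullet> (A *\<^sub>v p));
          x' = x + \<alpha> \<cdot>\<^sub>v p;
          r' = r - \<alpha> \<cdot>\<^sub>v (A *\<^sub>v p);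
          \<beta> = (r' \<bullet> (F *\<^sub>v r')) / (r \<bullet> (F *\<^sub>v r))
      in (x', r', F *\<^sub>v r' + \<beta> \<cdot>\<^sub>v p))"

definition pcg_iterate ::
  "real mat \<Rightarrow> real vec \<Rightarrow> real mat \<Rightarrow> real vec \<Rightarrow> nat \<Rightarrow> real vec" where
  "pcg_iterate A b F x0 m = fst (pcg_state A b F x0 m)"

definition P1_at_0 :: "real poly set" where
  "P1_at_0 = {p. degree p \<le> 1 \<and> poly p 0 = 1}"

end

theory Submission
  imports Defs
begin

text \<open>
  Write \<open>J\<close> for the complement of \<open>\<pi>\<close>. The expansion of \<open>r0\<close> in the orthonormal eigenbasis
  turns the numerator of \<open>\<theta>1\<close> into \<open>W = (\<Sum>i\<in>J. lam i * (\<eta> i)\<^sup>2)\<close> and its denominator into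
  \<open>V = (\<Sum>i\<in>J. (\<eta> i)\<^sup>2)\<close>. A polynomial of degree at most one with value \<open>1\<close> at \<open>0\<close> is
  \<open>1 - c t\<close>, and as a function of \<open>c\<close> the objective is a parabola with leading coefficient \<open>W\<close>
  and vertex \<open>c = V / W\<close>. So as soon as \<open>V > 0\<close> the minimiser is unique and its root is
  \<open>W / V = \<theta>1\<close> (\<open>linear_least_squares_root\<close>).

  That \<open>V > 0\<close> is where the iteration enters. If \<open>V = 0\<close>, then \<open>r0\<close> lies in the span of the
  \<open>k\<close> eigenvectors indexed by \<open>\<pi>\<close>. A feasible preconditioner may rescale \<open>k\<close> eigendirections by
  arbitrary positive factors, so it can be made to agree with the inverse of \<open>A\<close> on that span
  (\<open>deflating_preconditioner\<close>). The first search direction is then the whole error, the first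
  step reaches the solution, and the iteration never leaves it (\<open>pcg_exact_first_step\<close>). This
  contradicts the assumption that no feasible preconditioner has reached the solution at step
  \<open>l\<close>.
\<close>

section \<open>Weighted least squares for residual polynomials of degree one\<close>

lemma P1_at_0_eq: "P1_at_0 = range (\<lambda>c. [:1, - c:])"
proof (rule equalityI; rule subsetI)
  fix p :: "real poly" assume "p \<in> P1_at_0"
  then have "degree p \<le> 1" "coeff p 0 = 1"
    by (auto simp: P1_at_0_def poly_0_coeff_0)
  then have "p = [:1, - (- coeff p 1):]"
    by (intro poly_eqI)
      (auto simp: coeff_pCons coeff_eq_0 split: nat.split)
  then show "p \<in> range (\<lambda>c. [:1, - c:])" by blast
qed (auto simp: P1_at_0_def)

lemma square_expansion:
  fixes \<eta> :: "nat \<Rightarrow> real"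
  assumes pos: "\<And>i. i \<in> J \<Longrightarrow> 0 < lam i"
  shows "(\<Sum>i\<in>J. (\<eta> i)\<^sup>2 / lam i * (poly [:1, - c:] (lam i))\<^sup>2) =
     (\<Sum>i\<in>J. (\<eta> i)\<^sup>2 / lam i) - 2 * c * (\<Sum>i\<in>J. (\<eta> i)\<^sup>2) + c\<^sup>2 * (\<Sum>i\<in>J. lam i * (\<eta> i)\<^sup>2)"
proof -
  have "(\<eta> i)\<^sup>2 / lam i * (poly [:1, - c:] (lam i))\<^sup>2 =
      (\<eta> i)\<^sup>2 / lam i - 2 * c * (\<eta> i)\<^sup>2 + c\<^sup>2 * (lam i * (\<eta> i)\<^sup>2)" if "i \<in> J" for i
    using pos[OF that] by (simp add: field_simps power2_eq_square)
  then show ?thesis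
    by (simp add: sum.distrib sum_subtractf sum_distrib_left)
qed

text \<open>
  Completing the square in the coefficient \<open>c\<close>: the nonzero weight makes the quadratic
  coefficient positive, which gives uniqueness, and makes the minimising slope nonzero, so that
  the polynomial has exactly one root.
\<close>

lemma linear_least_squares_root:
  fixes \<eta> :: "nat \<Rightarrow> real"
  assumes fin: "finite J" and pos: "\<And>i. i \<in> J \<Longrightarrow> 0 < lam i"
    and nz: "\<exists>i\<in>J. \<eta> i \<noteq> 0"
  shows "\<exists>p1. {p. is_arg_min (\<lambda>p. \<Sum>i\<in>J. (\<eta> i)\<^sup>2 / lam i * (poly p (lam i))\<^sup>2)
                   (\<lambda>p. p \<in> P1_at_0) p} = {p1} \<and>
              {t. poly p1 t = 0} = {(\<Sum>i\<in>J. lam i * (\<eta> i)\<^sup>2) / (\<Sum>i\<in>J. (\<eta> i)\<^sup>2)}"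
proof -
  define V where "V = (\<Sum>i\<in>J. (\<eta> i)\<^sup>2)"
  define W where "W = (\<Sum>i\<in>J. lam i * (\<eta> i)\<^sup>2)"
  define f where "f = (\<lambda>p. \<Sum>i\<in>J. (\<eta> i)\<^sup>2 / lam i * (poly p (lam i))\<^sup>2)"
  obtain i where i: "i \<in> J" "\<eta> i \<noteq> 0" using nz by blast
  have V: "0 < V"
    unfolding V_def using i fin by (intro sum_pos2[of J i]) auto
  have W: "0 < W"
    unfolding W_def using i fin pos by (intro sum_pos2[of J i]) (auto simp: less_imp_le)
  have f_quadratic: "f [:1, - c:] = (\<Sum>i\<in>J. (\<eta> i)\<^sup>2 / lam i) - 2 * c * V + c\<^sup>2 * W" for c
    unfolding f_def V_def W_def by (rule square_expansion) (rule pos)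
  then have f: "f [:1, - c:] = f [:1, - (V / W):] + W * (c - V / W)\<^sup>2" for c
    using W by (simp add: f_quadratic field_simps power2_eq_square)
  have "is_arg_min f (\<lambda>p. p \<in> P1_at_0) p \<longleftrightarrow> p = [:1, - (V / W):]" for p
  proof
    assume p: "is_arg_min f (\<lambda>p. p \<in> P1_at_0) p"
    then obtain c where c: "p = [:1, - c:]"
      by (auto simp: is_arg_min_def P1_at_0_eq)
    have "f p \<le> f [:1, - (V / W):]"
      using p by (force simp: is_arg_min_linorder P1_at_0_eq)
    then have "W * (c - V / W)\<^sup>2 \<le> 0" using f[of c] c by simp
    then have "c = V / W" using W by (auto simp: mult_le_0_iff)
    then show "p = [:1, - (V / W):]" using c by simp
  next
    assume p: "p = [:1, - (V / W):]"
    have "f p \<le> f [:1, - c:]" for c using f[of c] W p by simp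
    then show "is_arg_min f (\<lambda>p. p \<in> P1_at_0) p"
      using p by (auto simp: is_arg_min_linorder P1_at_0_eq)
  qed
  then have "{p. is_arg_min f (\<lambda>p. p \<in> P1_at_0) p} = {[:1, - (V / W):]}" by blast
  moreover have "{t. poly [:1, - (V / W):] t = 0} = {W / V}"
    using V W by (auto simp: field_simps)
  ultimately show ?thesis unfolding f_def V_def W_def by blast
qed

section \<open>Diagonal matrices\<close>

lemma mat_diag_mult_vec:
  fixes v :: "'a :: semiring_0 vec"
  assumes "v \<in> carrier_vec n"
  shows "mat_diag n f *\<^sub>v v = vec n (\<lambda>i. f i * v $ i)"
  using assms
  by (intro eq_vecI) (auto simp: mat_diag_def scalar_prod_def if_distrib[of "\<lambda>x. x * _"] cong: if_cong)

lemma positive_definite_mat_diag: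
  assumes "\<And>i. i < n \<Longrightarrow> 0 < f i"
  shows "positive_definite n (mat_diag n f)"
  unfolding positive_definite_def
proof (intro conjI ballI impI)
  fix v :: "real vec" assume v: "v \<in> carrier_vec n" "v \<noteq> 0\<^sub>v n"
  then obtain i where i: "i < n" "v $ i \<noteq> 0"
    by (metis carrier_vecD eq_vecI index_zero_vec)
  have "v \<bullet> (mat_diag n f *\<^sub>v v) = (\<Sum>i<n. f i * (v $ i)\<^sup>2)"
    unfolding mat_diag_mult_vec[OF v(1)] using v(1)
    by (auto simp: scalar_prod_def lessThan_atLeast0 power2_eq_square intro!: sum.cong)
  also have "\<dots> > 0"
    using i assms by (intro sum_pos2[of _ i]) (auto simp: less_imp_le)
  finally show "0 < v \<bullet> (mat_diag n f *\<^sub>v v)" .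
qed (auto simp: mat_diag_def)

text \<open>
  The rank is the size of a maximal independent set of columns; such a set avoids the zero vector,
  hence every column that belongs to a vanishing diagonal entry.
\<close>

lemma rank_mat_diag_le:
  fixes f :: "nat \<Rightarrow> 'a :: field"
  shows "vec_space.rank n (mat_diag n f) \<le> card {i. i < n \<and> f i \<noteq> 0}"
proof -
  interpret vec_space "TYPE('a)" n .
  let ?D = "mat_diag n f" and ?I = "{i. i < n \<and> f i \<noteq> 0}"
  obtain U where U: "maximal U (\<lambda>T. T \<subseteq> set (cols ?D) \<and> lin_indpt T)"
    using maximal_exists_superset[of "set (cols ?D)" "\<lambda>T. T \<subseteq> set (cols ?D) \<and> lin_indpt T" "{}"]
    by (auto simp: finite_lin_indpt2)
  then have sub: "U \<subseteq> set (cols ?D)" and indpt: "lin_indpt U"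
    by (auto simp: maximal_def)
  have "U \<subseteq> carrier_vec n" using sub cols_dim[of ?D] by (auto simp: mat_diag_def)
  then have zero_notin: "0\<^sub>v n \<notin> U" using indpt vs_zero_lin_dep by auto
  have zero_col: "col ?D j = 0\<^sub>v n" if "j < n" "f j = 0" for j
    using that by (intro eq_vecI) (auto simp: mat_diag_def)
  have cols: "set (cols ?D) = col ?D ` {..<n}"
    by (auto simp: cols_def mat_diag_def)
  have "U \<subseteq> col ?D ` ?I"
  proof (intro subsetI)
    fix u assume "u \<in> U"
    then obtain j where j: "j < n" and u: "u = col ?D j" using sub cols by auto
    have "f j \<noteq> 0"
    proof
      assume "f j = 0"
      then have "u = 0\<^sub>v n" using zero_col[OF j] u by simp
      then show False using zero_notin \<open>u \<in> U\<close> by simp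
    qed
    with j u show "u \<in> col ?D ` ?I" by simp
  qed
  then have "card U \<le> card ?I"
    by (intro surj_card_le) auto
  then show ?thesis using rank_card_indpt[OF mat_diag_dim U] by simp
qed

section \<open>Conjugate gradients with an exact first step\<close>

lemma mat_inverse_mult_vec:
  assumes A: "positive_definite n A" and x: "x \<in> carrier_vec n" and b: "A *\<^sub>v x = b"
  shows "the (mat_inverse A) *\<^sub>v b = x"
proof -
  have Ac: "A \<in> carrier_mat n n" using A by (simp add: positive_definite_def)
  have "det A \<noteq> 0"
  proof
    assume "det A = 0"
    then obtain v where "v \<in> carrier_vec n" "v \<noteq> 0\<^sub>v n" "A *\<^sub>v v = 0\<^sub>v n"
      using det_0_iff_vec_prod_zero[OF Ac] by blast
    then show False using A by (force simp: positive_definite_def)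
  qed
  then have "A \<in> Units (ring_mat TYPE(real) n ())" by (rule det_non_zero_imp_unit[OF Ac])
  then obtain B where "mat_inverse A = Some B" using mat_inverse(1)[OF Ac] by fastforce
  moreover then have "B * A = 1\<^sub>m n" "B \<in> carrier_mat n n" using mat_inverse(2)[OF Ac] by auto
  ultimately show ?thesis
    using Ac x b by (metis assoc_mult_mat_vec one_mult_mat_vec option.sel)
qed

text \<open>
  With a zero residual both step quotients have numerator zero, hence are zero whatever their
  denominators, so the iterate and the residual no longer change. Only the direction is unspecified.
\<close>

lemma pcg_stays:
  assumes A: "A \<in> carrier_mat n n" and F: "F \<in> carrier_mat n n" and y: "y \<in> carrier_vec n"
    and "\<exists>p\<in>carrier_vec n. pcg_state A b F x0 m = (y, 0\<^sub>v n, p)"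
  shows "\<exists>p\<in>carrier_vec n. pcg_state A b F x0 (m + d) = (y, 0\<^sub>v n, p)"
proof (induction d)
  case 0
  then show ?case using assms by simp
next
  case (Suc d)
  then obtain p where p: "p \<in> carrier_vec n" "pcg_state A b F x0 (m + d) = (y, 0\<^sub>v n, p)"
    by blast
  have "F *\<^sub>v 0\<^sub>v n = 0\<^sub>v n" using F by auto
  moreover have "0 \<cdot>\<^sub>v p = 0\<^sub>v n" "0 \<cdot>\<^sub>v (A *\<^sub>v p) = 0\<^sub>v n" using A p(1) by auto
  ultimately show ?case using p y by (simp add: Let_def)
qed

text \<open>
  The hypothesis on \<open>F\<close> says that the first direction \<open>p\<close> solves the residual equation, that is,
  \<open>x0 + p\<close> is the solution. The step length is then a quotient of equal numbers, which is \<open>1\<close>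
  unless the initial residual vanishes already.
\<close>

lemma pcg_exact_first_step:
  assumes A: "positive_definite n A" and F: "F \<in> carrier_mat n n"
    and b: "b \<in> carrier_vec n" and x0: "x0 \<in> carrier_vec n"
    and exact: "A *\<^sub>v (F *\<^sub>v (b - A *\<^sub>v x0)) = b - A *\<^sub>v x0"
    and l: "1 \<le> l"
  shows "pcg_iterate A b F x0 l = the (mat_inverse A) *\<^sub>v b"
proof -
  have Ac: "A \<in> carrier_mat n n" using A by (simp add: positive_definite_def)
  define r where "r = b - A *\<^sub>v x0"
  define p where "p = F *\<^sub>v r"
  have r: "r \<in> carrier_vec n" using Ac b x0 by (simp add: r_def)
  have p: "p \<in> carrier_vec n" using F r by (simp add: p_def)
  have Ap: "A *\<^sub>v p = r" using exact by (simp add: r_def p_def)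
  define \<alpha> where "\<alpha> = (r \<bullet> p) / (p \<bullet> r)"
  \<comment> \<open>In the degenerate case \<open>p = 0\<close> the quotient is \<open>0 / 0 = 0\<close>, but then the scaled vectors are zero
    as well; stating the step in this form covers both cases.\<close>
  have step: "\<alpha> \<cdot>\<^sub>v p = p \<and> \<alpha> \<cdot>\<^sub>v r = r"
  proof (cases "p = 0\<^sub>v n")
    case True
    then have "r = 0\<^sub>v n" using Ap Ac by auto
    then show ?thesis using True by auto
  next
    case False
    then have "0 < p \<bullet> (A *\<^sub>v p)" using A p by (simp add: positive_definite_def)
    then have "0 < p \<bullet> r" by (simp add: Ap)
    moreover have "r \<bullet> p = p \<bullet> r" using r p by (rule comm_scalar_prod)
    ultimately have "\<alpha> = 1" by (simp add: \<alpha>_def)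
    then show ?thesis by simp
  qed
  have "pcg_state A b F x0 (Suc 0) =
      (x0 + p, 0\<^sub>v n, F *\<^sub>v 0\<^sub>v n + ((0\<^sub>v n \<bullet> (F *\<^sub>v 0\<^sub>v n)) / (r \<bullet> p)) \<cdot>\<^sub>v p)"
    using step r by (simp add: Let_def r_def[symmetric] p_def[symmetric] Ap \<alpha>_def[symmetric])
  then have "\<exists>q\<in>carrier_vec n. pcg_state A b F x0 1 = (x0 + p, 0\<^sub>v n, q)"
    using F p by simp
  then have "\<exists>q\<in>carrier_vec n. pcg_state A b F x0 (1 + (l - 1)) = (x0 + p, 0\<^sub>v n, q)"
    using x0 p by (intro pcg_stays[OF Ac F]) auto
  then have "pcg_iterate A b F x0 l = x0 + p"
    using l by (auto simp: pcg_iterate_def)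
  moreover have "A *\<^sub>v (x0 + p) = b"
    using Ac b x0 p by (auto simp: mult_add_distrib_mat_vec[OF Ac x0 p] Ap r_def)
  then have "the (mat_inverse A) *\<^sub>v b = x0 + p"
    using x0 p by (intro mat_inverse_mult_vec[OF A]) auto
  ultimately show ?thesis by simp
qed

section \<open>Deflating the spectral components of a residual\<close>

text \<open>
  In the eigenbasis \<open>A\<close> and \<open>F\<close> are diagonal, so \<open>F\<close> inverts \<open>A\<close> on the \<open>i\<close>-th eigendirection
  exactly when \<open>1 + d i = 1 / lam i\<close>. Making this choice on \<open>I\<close> costs rank at most \<open>card I\<close>, and
  it suffices for a vector without components outside \<open>I\<close>.
\<close>

lemma deflating_preconditioner:
  fixes lam :: "nat \<Rightarrow> real"
  assumes orth: "orthonormal_mat n S"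
    and spectral: "A = S * mat_diag n lam * S\<^sup>T"
    and lam_pos: "\<And>i. i < n \<Longrightarrow> 0 < lam i"
    and r: "r \<in> carrier_vec n"
    and I: "finite I" "card I \<le> k"
    and supp: "\<And>i. i < n \<Longrightarrow> i \<notin> I \<Longrightarrow> (S\<^sup>T *\<^sub>v r) $ i = 0"
  shows "\<exists>F\<in>carrier_mat n n. feasible_preconditioner n k S F \<and> A *\<^sub>v (F *\<^sub>v r) = r"
proof -
  have S: "S \<in> carrier_mat n n" and StS: "S\<^sup>T * S = 1\<^sub>m n" and SSt: "S * S\<^sup>T = 1\<^sub>m n"
    using orth by (auto simp: orthonormal_mat_def)
  have St: "S\<^sup>T \<in> carrier_mat n n" using S by simp
  define d where "d = (\<lambda>i. if i \<in> I then 1 / lam i - 1 else 0)"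
  define D where "D = mat_diag n d"
  define F where "F = 1\<^sub>m n + S * D * S\<^sup>T"
  have D: "D \<in> carrier_mat n n" by (simp add: D_def)
  have F: "F \<in> carrier_mat n n" using S D by (simp add: F_def)
  have "1\<^sub>m n + D = mat_diag n (\<lambda>i. 1 + d i)"
    by (rule eq_matI) (auto simp: D_def mat_diag_def)
  moreover have "positive_definite n (mat_diag n (\<lambda>i. 1 + d i))"
    by (rule positive_definite_mat_diag) (auto simp: d_def lam_pos)
  moreover have "vec_space.rank n D \<le> k"
  proof -
    have "card {i. i < n \<and> d i \<noteq> 0} \<le> card I"
      using I by (intro card_mono) (auto simp: d_def)
    then show ?thesis using rank_mat_diag_le[of n d] I by (simp add: D_def)
  qed
  moreover have "diagonal_mat D" by (auto simp: diagonal_mat_def D_def mat_diag_def)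
  ultimately have "feasible_preconditioner n k S F"
    using D by (auto simp: feasible_preconditioner_def F_def)
  moreover have "A *\<^sub>v (F *\<^sub>v r) = r"
  proof -
    define w where "w = S\<^sup>T *\<^sub>v r"
    have w: "w \<in> carrier_vec n" using St r by (simp add: w_def)
    have r_eq: "r = S *\<^sub>v w"
      unfolding w_def using assoc_mult_mat_vec[OF S St r] SSt r by simp
    define u where "u = w + D *\<^sub>v w"
    have u: "u \<in> carrier_vec n" using w D by (simp add: u_def)
    have "F *\<^sub>v r = S *\<^sub>v w + S *\<^sub>v (D *\<^sub>v w)"
    proof -
      have "S * D * S\<^sup>T *\<^sub>v r = S *\<^sub>v (D *\<^sub>v w)"
        using S D St r by (simp add: w_def assoc_mult_mat_vec[of _ n n _ n])
      then show ?thesis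
        using S D St r by (simp add: F_def add_mult_distrib_mat_vec[of _ n n] r_eq[symmetric])
    qed
    also have "\<dots> = S *\<^sub>v u"
      using S D w by (simp add: u_def mult_add_distrib_mat_vec[of _ n n])
    finally have Fr: "F *\<^sub>v r = S *\<^sub>v u" .
    have "S\<^sup>T *\<^sub>v (S *\<^sub>v u) = u"
      using assoc_mult_mat_vec[OF St S u] StS u by simp
    then have "A *\<^sub>v (F *\<^sub>v r) = S *\<^sub>v (mat_diag n lam *\<^sub>v u)"
      using S St u by (simp add: Fr spectral assoc_mult_mat_vec[of _ n n _ n])
    also have "mat_diag n lam *\<^sub>v u = w"
    proof (rule eq_vecI)
      fix i assume "i < dim_vec w"
      then have i: "i < n" using w by simp
      have "(mat_diag n lam *\<^sub>v u) $ i = lam i * ((1 + d i) * w $ i)"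
        using i w u by (simp add: mat_diag_mult_vec u_def D_def algebra_simps)
      also have "\<dots> = w $ i"
        using supp[OF i] lam_pos[OF i] by (auto simp: d_def w_def[symmetric])
      finally show "(mat_diag n lam *\<^sub>v u) $ i = w $ i" .
    qed (use w u in \<open>simp add: mat_diag_def\<close>)
    finally show ?thesis using r_eq by simp
  qed
  ultimately show ?thesis using F by blast
qed

lemma quadratic_form_spectral:
  fixes lam :: "nat \<Rightarrow> real"
  assumes orth: "orthonormal_mat n S" and r: "r \<in> carrier_vec n"
  shows "r \<bullet> (S * mat_diag n lam * S\<^sup>T *\<^sub>v r) = (\<Sum>i<n. lam i * ((S\<^sup>T *\<^sub>v r) $ i)\<^sup>2)"
proof -
  have S: "S \<in> carrier_mat n n" and St: "S\<^sup>T \<in> carrier_mat n n"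
    using orth by (auto simp: orthonormal_mat_def)
  define w where "w = S\<^sup>T *\<^sub>v r"
  have w: "w \<in> carrier_vec n" using St r by (simp add: w_def)
  have "r \<bullet> (S * mat_diag n lam * S\<^sup>T *\<^sub>v r) = r \<bullet> (S *\<^sub>v (mat_diag n lam *\<^sub>v w))"
    using S St r by (simp add: w_def assoc_mult_mat_vec[of _ n n _ n])
  also have "\<dots> = w \<bullet> (mat_diag n lam *\<^sub>v w)"
  proof -
    have "mat_diag n lam *\<^sub>v w \<in> carrier_vec n"
      using w by (intro mult_mat_vec_carrier[OF mat_diag_dim])
    then show ?thesis using transpose_vec_mult_scalar[OF S _ r] by (simp add: w_def)
  qed
  also have "\<dots> = (\<Sum>i<n. lam i * (w $ i)\<^sup>2)"
    using w by (auto simp: mat_diag_mult_vec scalar_prod_def lessThan_atLeast0 power2_eq_square intro!: sum.cong)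
  finally show ?thesis by (simp add: w_def)
qed

section \<open>The root of the optimal residual polynomial\<close>

(* The indices 1..n of the eigenvalues and eigenvectors are kept 1-based; only the entries
   of the diagonal matrix are 0-based, as everywhere for matrices. *)
theorem theorem4p4:
  fixes n k l j0 :: nat
    and A S :: "real mat"
    and lam :: "nat \<Rightarrow> real"
    and s :: "nat \<Rightarrow> real vec"
    and b x0 r0 xstar :: "real vec"
    and \<eta> :: "nat \<Rightarrow> real"
    and \<pi> :: "nat set"
    and \<theta>1 :: real
  assumes A: "positive_definite n A"
    and s: "\<forall>i \<in> {1..n}. s i \<in> carrier_vec n"
    and S: "S = mat_of_cols n (map s [1..<Suc n])"
    and orth: "orthonormal_mat n S"
    and spectral: "A = S * mat_diag n (\<lambda>i. lam (Suc i)) * S\<^sup>T"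
    and ordered: "antimono_on {1..n} lam"
    and lam_pos: "\<forall>i \<in> {1..n}. 0 < lam i"
    and b: "b \<in> carrier_vec n"
    and x0: "x0 \<in> carrier_vec n"
    and xstar: "xstar = the (mat_inverse A) *\<^sub>v b"
    and r0: "r0 = b - A *\<^sub>v x0"
    and eta: "\<forall>i \<in> {1..n}. \<eta> i = s i \<bullet> r0"
    and k: "1 < k" "k < n"
    and j0: "is_arg_min (\<lambda>j. lam j / lam (n - k + j - 1)) (\<lambda>j. j \<in> {1..k + 1}) j0"
    and pi: "\<pi> \<subseteq> {1..n}" "card \<pi> = k" "{1..n} - \<pi> = {j0..n - k + j0 - 1}"
    and l: "1 \<le> l"
    and not_reached: "\<forall>F. feasible_preconditioner n k S F \<longrightarrow> pcg_iterate A b F x0 l \<noteq> xstar"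
    and theta1: "\<theta>1 = (r0 \<bullet> (A *\<^sub>v r0) - (\<Sum>i\<in>\<pi>. lam i * (s i \<bullet> r0)\<^sup>2))
                    / (r0 \<bullet> r0 - (\<Sum>i\<in>\<pi>. (s i \<bullet> r0)\<^sup>2))"
  shows "\<exists>p1D.
           {p. is_arg_min (\<lambda>p. \<Sum>i\<in>{1..n} - \<pi>. (\<eta> i)\<^sup>2 / lam i * (poly p (lam i))\<^sup>2)
                 (\<lambda>p. p \<in> P1_at_0) p} = {p1D} \<and>
           {t. poly p1D t = 0} = {\<theta>1}"
proof -
  define J where "J = {1..n} - \<pi>"
  define w where "w = S\<^sup>T *\<^sub>v r0"
  have Sc: "S \<in> carrier_mat n n" and SSt: "S * S\<^sup>T = 1\<^sub>m n"
    using orth by (auto simp: orthonormal_mat_def)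
  have Ac: "A \<in> carrier_mat n n" using A by (simp add: positive_definite_def)
  have r0c: "r0 \<in> carrier_vec n" using Ac b x0 by (simp add: r0)
  have w_nth: "w $ i = s (Suc i) \<bullet> r0" if "i < n" for i
  proof -
    have "col S i = s (Suc i)"
      using that s unfolding S by (subst col_mat_of_cols) (auto simp del: upt_Suc)
    then show ?thesis using that Sc by (simp add: w_def)
  qed
  have reindex: "(\<Sum>i<n. g (Suc i)) = (\<Sum>i\<in>{1..n}. g i)" for g :: "nat \<Rightarrow> real"
    using sum.atLeast1_atMost_eq[of g n] by simp
  have split: "(\<Sum>i\<in>{1..n}. g i) - (\<Sum>i\<in>\<pi>. g i) = (\<Sum>i\<in>J. g i)" for g :: "nat \<Rightarrow> real"
    unfolding J_def using pi(1) by (simp add: sum_diff)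
  have "r0 \<bullet> (A *\<^sub>v r0) = (\<Sum>i<n. lam (Suc i) * (s (Suc i) \<bullet> r0)\<^sup>2)"
    using quadratic_form_spectral[OF orth r0c, of "\<lambda>i. lam (Suc i)"] w_nth
    by (simp add: spectral w_def)
  then have num: "r0 \<bullet> (A *\<^sub>v r0) - (\<Sum>i\<in>\<pi>. lam i * (s i \<bullet> r0)\<^sup>2) = (\<Sum>i\<in>J. lam i * (s i \<bullet> r0)\<^sup>2)"
    using reindex[of "\<lambda>i. lam i * (s i \<bullet> r0)\<^sup>2"] split[of "\<lambda>i. lam i * (s i \<bullet> r0)\<^sup>2"] by simp
  \<comment> \<open>The squared norm is the case in which all eigenvalues are \<open>1\<close>.\<close>
  have "r0 \<bullet> r0 = (\<Sum>i<n. (s (Suc i) \<bullet> r0)\<^sup>2)"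
    using quadratic_form_spectral[OF orth r0c, of "\<lambda>_. 1"] w_nth Sc SSt r0c by (simp add: w_def)
  then have den: "r0 \<bullet> r0 - (\<Sum>i\<in>\<pi>. (s i \<bullet> r0)\<^sup>2) = (\<Sum>i\<in>J. (s i \<bullet> r0)\<^sup>2)"
    using reindex[of "\<lambda>i. (s i \<bullet> r0)\<^sup>2"] split[of "\<lambda>i. (s i \<bullet> r0)\<^sup>2"] by simp
  have eta_J: "\<eta> i = s i \<bullet> r0" if "i \<in> J" for i using that eta by (simp add: J_def)
  have "\<theta>1 = (\<Sum>i\<in>J. lam i * (\<eta> i)\<^sup>2) / (\<Sum>i\<in>J. (\<eta> i)\<^sup>2)"
    unfolding theta1 num den using eta_J by simp
  moreover have "\<exists>i\<in>J. \<eta> i \<noteq> 0"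
  proof (rule ccontr)
    assume "\<not> (\<exists>i\<in>J. \<eta> i \<noteq> 0)"
    then have zero: "\<eta> i = 0" if "i \<in> J" for i using that by blast
    \<comment> \<open>\<open>\<pi>\<close> counts from \<open>1\<close>, the rows and columns of a matrix from \<open>0\<close>.\<close>
    define I where "I = {i. Suc i \<in> \<pi>}"
    have Suc_I: "Suc ` I = \<pi>"
    proof
      show "\<pi> \<subseteq> Suc ` I"
      proof
        fix i assume i: "i \<in> \<pi>"
        then obtain m where "i = Suc m" using pi(1) by (cases i) auto
        then show "i \<in> Suc ` I" using i by (auto simp: I_def)
      qed
    qed (auto simp: I_def)
    have "finite \<pi>" using pi(1) by (rule finite_subset) simp
    then have finI: "finite I" using Suc_I by (metis finite_imageD inj_Suc)
    have cardI: "card I \<le> k" using Suc_I pi(2) by (metis card_image inj_Suc order_refl)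
    have supp: "(S\<^sup>T *\<^sub>v r0) $ i = 0" if "i < n" "i \<notin> I" for i
    proof -
      have "Suc i \<in> J" using that by (simp add: J_def I_def)
      then show ?thesis using w_nth[OF that(1)] zero eta_J by (simp add: w_def)
    qed
    obtain F where "F \<in> carrier_mat n n" "feasible_preconditioner n k S F"
        "A *\<^sub>v (F *\<^sub>v r0) = r0"
      using deflating_preconditioner[OF orth spectral _ r0c finI cardI supp] lam_pos by auto
    then show False
      using pcg_exact_first_step[OF A _ b x0 _ l, of F] not_reached xstar r0 by auto
  qed
  ultimately show ?thesis
    using linear_least_squares_root[of J lam \<eta>] lam_pos by (auto simp: J_def)
qed

end
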